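(* Let $A$ be a finite non-empty subset of a commutative group and let $K$ be a real number with $|A+A| \leq K|A|$. Suppose $|A+A+A| \geq \frac{1}{M}K^{3/2}|A|^{3/2}$, where $M$ is a real number with $1\leq M \leq \frac{1}{2}\sqrt{\frac{|A|}{K}}$. Then there exists $Y \subset A$ such that (1) $\displaystyle \frac{\sqrt{K|A|}}{(2M)^{1/3}} \leq |Y| < 2M\sqrt{K|A|}$, and (2) $\displaystyle |Y+Y+Y| \geq \frac{|Y|^3}{(2M)^4}$.
   Context: For a subset $A$ of a commutative group (written additively), $A+A=\{a+b : a,b\in A\}$ and $A+A+A=\{a+b+c : a,b,c\in A\}$; $|\cdot|$ denotes cardinality. The inclusion $Y\subset A$ is not required to be proper. *)

theory Defs
  imports Complex_Main "HOL-Library.Set_Algebras"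
begin

end

theory Submission
  imports Defs
begin

text \<open>
  Write \<open>p = K * card A\<close> and \<open>L = 2 * M * sqrt p\<close>. The set \<open>Y\<close> is obtained from \<open>A\<close> by deleting
  elements one at a time, always one whose deletion destroys few elements of the double sumset.

  Deleting \<open>x\<close> destroys, say, \<open>d\<close> elements of \<open>Y + Y\<close>. An element of \<open>Y + Y\<close> can be destroyed by
  at most two choices of \<open>x\<close>, the summands of any one of its representations, so some \<open>x\<close> has
  \<open>d * card Y \<le> 2 * card (Y + Y)\<close> (\<open>exists_cheap_deletion\<close>). The triple sums destroyed
  along with \<open>x\<close> lie in \<open>x + D + D\<close>, where \<open>D\<close> is the set of the \<open>d\<close> elements \<open>y\<close> for which \<open>x + y\<close>
  is destroyed, so there are at most \<open>d * (d + 1) / 2\<close> of them (\<open>card_triple_sumset_deletion\<close>).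

  As long as \<open>card Y \<ge> L\<close>, these two bounds show that the potential
  \<open>card (Y + Y + Y) - (card (Y + Y))\<^sup>2 / L\<close> does not drop (\<open>potential_deletion\<close>). It is at least
  \<open>p powr (3/2) / M - p\<^sup>2 / L = p powr (3/2) / (2 * M)\<close> for \<open>A\<close>, so once the deletions have brought
  the size below \<open>L\<close> there are still at least \<open>p powr (3/2) / (2 * M)\<close> triple sums. The lower bound
  on \<open>card Y\<close> follows from \<open>card (Y + Y + Y) \<le> card Y ^ 3\<close>, and the bound on triple sums in terms
  of \<open>card Y\<close> follows from \<open>card Y < L\<close>.
\<close>

section \<open>Sizes of sumsets\<close>

lemma card_set_plus_le:
  fixes A B :: "'a::ab_group_add set"
  assumes "finite A" "finite B"
  shows "card (A + B) \<le> card A * card B"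
proof -
  have "A + B = (\<lambda>(a, b). a + b) ` (A \<times> B)"
    by (auto simp: set_plus_def)
  then show ?thesis
    using card_image_le[of "A \<times> B" "\<lambda>(a, b). a + b"] assms by (simp add: card_cartesian_product)
qed

lemma card_le_card_double_sumset:
  fixes A :: "'a::ab_group_add set"
  assumes "finite A"
  shows "card A \<le> card (A + A)"
proof (cases "A = {}")
  case False
  then obtain a where "a \<in> A" by blast
  then have "(+) a ` A \<subseteq> A + A"
    by (auto simp: set_plus_def)
  then have "card ((+) a ` A) \<le> card (A + A)"
    using assms by (intro card_mono finite_set_plus)
  then show ?thesis
    by (simp add: card_image)
qed simp

lemma card_double_sumset_le:
  fixes D :: "'a::ab_group_add set"
  assumes "finite D"
  shows "2 * card (D + D) \<le> card D * (card D + 1)"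
  using assms
proof (induction D rule: finite_induct)
  case empty
  then show ?case by (simp add: set_plus_def)
next
  case (insert x F)
  have "insert x F + insert x F \<subseteq> (F + F) \<union> (+) x ` insert x F"
    by (auto simp: set_plus_def add.commute)
  then have "card (insert x F + insert x F) \<le> card ((F + F) \<union> (+) x ` insert x F)"
    using insert by (intro card_mono finite_UnI finite_set_plus finite_imageI) auto
  also have "\<dots> \<le> card (F + F) + card ((+) x ` insert x F)"
    by (rule card_Un_le)
  also have "card ((+) x ` insert x F) = card F + 1"
    using insert by (subst card_image) auto
  finally show ?case
    using insert by simp
qed

section \<open>Deleting one element\<close>

text \<open>Averaging over \<open>x\<close>: a sum \<open>a + b\<close> survives the deletion of every \<open>x\<close> other than \<open>a\<close>
  and \<open>b\<close>, so it is counted at most twice when the destroyed sums are added up over all \<open>x\<close>.\<close>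

lemma exists_cheap_deletion:
  fixes Y :: "'a::ab_group_add set"
  assumes "finite Y" "Y \<noteq> {}"
  shows "\<exists>x\<in>Y. card ((Y + Y) - ((Y - {x}) + (Y - {x}))) * card Y \<le> 2 * card (Y + Y)"
proof (rule ccontr)
  define N where "N x = (Y + Y) - ((Y - {x}) + (Y - {x}))" for x
  assume "\<not> ?thesis"
  then have big: "2 * card (Y + Y) < card (N x) * card Y" if "x \<in> Y" for x
    using that by (auto simp: N_def not_le)
  have fin: "finite (Y + Y)"
    using assms by (intro finite_set_plus)
  have two: "card {x \<in> Y. s \<in> N x} \<le> 2" if s: "s \<in> Y + Y" for s
  proof -
    obtain a b where ab: "a \<in> Y" "b \<in> Y" "s = a + b"
      using s by (auto simp: set_plus_def)
    have "{x \<in> Y. s \<in> N x} \<subseteq> {a, b}"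
      using ab by (auto simp: N_def set_plus_def)
    then have "card {x \<in> Y. s \<in> N x} \<le> card {a, b}"
      by (intro card_mono) auto
    also have "\<dots> \<le> 2"
      by (simp add: card_insert_if)
    finally show ?thesis .
  qed
  have "(\<Sum>x\<in>Y. card (N x)) = (\<Sum>x\<in>Y. card {s \<in> Y + Y. s \<in> N x})"
    by (intro sum.cong arg_cong[where f = card]) (auto simp: N_def)
  also have "\<dots> = (\<Sum>s\<in>Y + Y. card {x \<in> Y. s \<in> N x})"
    using sum_multicount_gen[OF assms(1) fin, where R = "\<lambda>x s. s \<in> N x"
        and k = "\<lambda>s. card {x \<in> Y. s \<in> N x}"] by simp
  also have "\<dots> \<le> (\<Sum>s\<in>Y + Y. 2)"
    using two by (rule sum_mono)
  finally have le: "(\<Sum>x\<in>Y. card (N x)) \<le> 2 * card (Y + Y)"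
    by (simp add: mult.commute)
  have "card Y * (2 * card (Y + Y)) = (\<Sum>x\<in>Y. 2 * card (Y + Y))"
    by simp
  also have "\<dots> < (\<Sum>x\<in>Y. card (N x) * card Y)"
    using big assms by (intro sum_strict_mono) auto
  also have "\<dots> = card Y * (\<Sum>x\<in>Y. card (N x))"
    by (simp add: sum_distrib_left mult.commute)
  also have "\<dots> \<le> card Y * (2 * card (Y + Y))"
    using le by (rule mult_left_mono) simp
  finally show False by simp
qed

text \<open>A destroyed triple sum has the form \<open>x + y + z\<close>. Usually both \<open>x + y\<close> and \<open>x + z\<close> are
  destroyed as well. The exception is \<open>z = x\<close> with \<open>x + y = u + v\<close> surviving, and then the
  same argument applies to the representation \<open>x + u + v\<close> instead.\<close>

lemma card_triple_sumset_deletion: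
  fixes Y :: "'a::ab_group_add set"
  assumes "finite Y" "x \<in> Y"
  defines "Y' \<equiv> Y - {x}"
  defines "d \<equiv> card ((Y + Y) - (Y' + Y'))"
  shows "2 * card (Y + Y + Y) \<le> 2 * card (Y' + Y' + Y') + d * (d + 1)"
proof -
  define D where "D = {y \<in> Y. x + y \<notin> Y' + Y'}"
  have finD: "finite D"
    using assms by (simp add: D_def)
  have dD: "d = card D"
  proof -
    have "(+) x ` D = (Y + Y) - (Y' + Y')"
    proof
      show "(+) x ` D \<subseteq> (Y + Y) - (Y' + Y')"
        using assms(2) by (auto simp: D_def)
      show "(Y + Y) - (Y' + Y') \<subseteq> (+) x ` D"
      proof
        fix s assume s: "s \<in> (Y + Y) - (Y' + Y')"
        then obtain a b where ab: "a \<in> Y" "b \<in> Y" "s = a + b"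
          by (auto simp: set_plus_def)
        then have "a = x \<or> b = x"
          using s by (auto simp: Y'_def set_plus_def)
        then obtain y where "y \<in> Y" "s = x + y"
          using ab by (auto simp: add.commute)
        then show "s \<in> (+) x ` D"
          using s by (auto simp: D_def)
      qed
    qed
    then have "d = card ((+) x ` D)"
      by (simp add: d_def)
    then show ?thesis
      by (simp add: card_image)
  qed
  have sub: "Y + Y + Y \<subseteq> (Y' + Y' + Y') \<union> (+) x ` (D + D)"
  proof
    fix c assume c: "c \<in> Y + Y + Y"
    show "c \<in> (Y' + Y' + Y') \<union> (+) x ` (D + D)"
    proof (rule ccontr)
      assume neg: "c \<notin> (Y' + Y' + Y') \<union> (+) x ` (D + D)"
      have no3: "c \<noteq> s + z" if "s \<in> Y' + Y'" "z \<in> Y'" for s z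
        using neg that by auto
      have noD: "\<not> (y \<in> D \<and> z \<in> D)" if "c = x + (y + z)" for y z
        using neg that by auto
      have no_xuv: "c \<noteq> x + (u + v)" if uv: "u \<in> Y'" "v \<in> Y'" for u v
      proof
        assume ceq: "c = x + (u + v)"
        then have "u \<notin> D \<or> v \<notin> D"
          using noD by blast
        then have "x + u \<in> Y' + Y' \<or> x + v \<in> Y' + Y'"
          using uv by (auto simp: D_def Y'_def)
        then show False
          using no3[of "x + u" v] no3[of "x + v" u] uv ceq by (auto simp: ac_simps)
      qed
      have no_x: False if yz: "y \<in> Y" "z \<in> Y" "c = x + (y + z)" "y \<notin> D" for y z
      proof -
        have xy: "x + y \<in> Y' + Y'"
          using yz by (auto simp: D_def)
        then have "z = x"
          using no3[of "x + y" z] yz by (auto simp: Y'_def ac_simps)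
        moreover obtain u v where "u \<in> Y'" "v \<in> Y'" "x + y = u + v"
          using xy by (auto simp: set_plus_def)
        ultimately show False
          using no_xuv[of u v] yz by (auto simp: ac_simps)
      qed
      obtain a b e where abe: "a \<in> Y" "b \<in> Y" "e \<in> Y" "c = a + b + e"
        using c by (auto simp: set_plus_def)
      then have "a = x \<or> b = x \<or> e = x"
        using no3[of "a + b" e] by (auto simp: Y'_def)
      then obtain y z where "y \<in> Y" "z \<in> Y" "c = x + (y + z)"
        using abe by (metis add.assoc add.commute)
      then show False
        using no_x[of y z] no_x[of z y] noD[of y z] by (auto simp: ac_simps)
    qed
  qed
  have "finite (Y' + Y' + Y')" "finite (D + D)"
    using assms finD by (auto simp: Y'_def intro!: finite_set_plus)
  then have "card (Y + Y + Y) \<le> card ((Y' + Y' + Y') \<union> (+) x ` (D + D))"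
    using sub by (intro card_mono) auto
  also have "\<dots> \<le> card (Y' + Y' + Y') + card ((+) x ` (D + D))"
    by (rule card_Un_le)
  also have "card ((+) x ` (D + D)) = card (D + D)"
    by (simp add: card_image)
  finally show ?thesis
    using card_double_sumset_le[OF finD] dD by simp
qed

text \<open>The choice of potential: when \<open>d\<close> of \<open>q\<close> double sums are lost, \<open>q\<^sup>2 / L\<close> decreases by
  \<open>d * (2 * q - d) / L\<close>, which pays for \<open>d * (d + 1) / 2\<close> lost triple sums as soon as
  \<open>L * d + L + 2 * d \<le> 4 * q\<close>. Cheapness of the deletion gives \<open>L * d \<le> 2 * q\<close>, the size
  of \<open>Y\<close> gives \<open>L \<le> q\<close>, and \<open>4 \<le> L\<close> turns the former into \<open>2 * d \<le> q\<close>.\<close>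

lemma potential_deletion:
  fixes Y :: "'a::ab_group_add set" and L :: real
  assumes "finite Y" "4 \<le> L" "L \<le> real (card Y)"
  shows "\<exists>x\<in>Y. real (card (Y + Y + Y)) - (real (card (Y + Y)))\<^sup>2 / L
    \<le> real (card ((Y - {x}) + (Y - {x}) + (Y - {x})))
      - (real (card ((Y - {x}) + (Y - {x}))))\<^sup>2 / L"
proof -
  have "Y \<noteq> {}"
    using assms by auto
  then obtain x where x: "x \<in> Y"
    and cheap: "card ((Y + Y) - ((Y - {x}) + (Y - {x}))) * card Y \<le> 2 * card (Y + Y)"
    using exists_cheap_deletion assms(1) by blast
  define Y' where "Y' = Y - {x}"
  define n where "n = card ((Y + Y) - (Y' + Y'))"
  define d q where "d = real n" and "q = real (card (Y + Y))"
  have fin: "finite (Y + Y)"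
    using assms by (intro finite_set_plus)
  have "Y' + Y' \<subseteq> Y + Y"
    unfolding Y'_def by (intro set_plus_mono2) auto
  then have "card (Y' + Y') + n = card (Y + Y)"
    unfolding n_def using fin by (metis card_Diff_subset card_mono finite_subset le_add_diff_inverse)
  then have q': "real (card (Y' + Y')) = q - d"
    unfolding d_def q_def by linarith
  have "2 * card (Y + Y + Y) \<le> 2 * card (Y' + Y' + Y') + n * (n + 1)"
    using card_triple_sumset_deletion[OF assms(1) x] by (simp add: Y'_def n_def)
  then have "real (2 * card (Y + Y + Y)) \<le> real (2 * card (Y' + Y' + Y') + n * (n + 1))"
    by (rule of_nat_mono)
  then have triple: "2 * real (card (Y + Y + Y)) \<le> 2 * real (card (Y' + Y' + Y')) + d * (d + 1)"
    by (simp add: d_def algebra_simps)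
  have d0: "0 \<le> d"
    by (simp add: d_def)
  have "real (n * card Y) \<le> real (2 * card (Y + Y))"
    using cheap unfolding n_def Y'_def by (rule of_nat_mono)
  then have "d * real (card Y) \<le> 2 * q"
    by (simp add: d_def q_def)
  moreover have "d * L \<le> d * real (card Y)"
    using assms(3) d0 by (rule mult_left_mono)
  ultimately have dL: "d * L \<le> 2 * q"
    by linarith
  have "d * 4 \<le> d * L"
    using assms(2) d0 by (rule mult_left_mono)
  moreover have "L \<le> q"
    using card_le_card_double_sumset[OF assms(1)] assms(3) by (simp add: q_def)
  ultimately have "L * (d + 1) \<le> 2 * (2 * q - d)"
    using dL by (simp add: algebra_simps)
  then have "d * (L * (d + 1)) \<le> d * (2 * (2 * q - d))"
    using d0 by (rule mult_left_mono)
  then have "d * (d + 1) / 2 \<le> (q\<^sup>2 - (q - d)\<^sup>2) / L"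
    using assms(2) by (simp add: field_simps power2_eq_square)
  then have "real (card (Y + Y + Y)) - q\<^sup>2 / L \<le> real (card (Y' + Y' + Y')) - (q - d)\<^sup>2 / L"
    using triple unfolding diff_divide_distrib by linarith
  then show ?thesis
    using x unfolding q'[symmetric] unfolding Y'_def q_def by blast
qed

section \<open>Repeated deletion\<close>

lemma exists_small_subset_potential:
  fixes A :: "'a::ab_group_add set" and L :: real
  assumes "finite A" "4 \<le> L"
  shows "\<exists>Y\<subseteq>A. real (card Y) < L \<and>
    real (card (A + A + A)) - (real (card (A + A)))\<^sup>2 / L
      \<le> real (card (Y + Y + Y)) - (real (card (Y + Y)))\<^sup>2 / L"
  using assms(1)
proof (induction A rule: finite_psubset_induct)
  case (psubset A)
  show ?case
  proof (cases "real (card A) < L")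
    case True
    then show ?thesis by blast
  next
    case False
    then obtain x where "x \<in> A" and x: "real (card (A + A + A)) - (real (card (A + A)))\<^sup>2 / L
        \<le> real (card ((A - {x}) + (A - {x}) + (A - {x})))
          - (real (card ((A - {x}) + (A - {x}))))\<^sup>2 / L"
      using potential_deletion[OF psubset.hyps assms(2)] by auto
    then have "A - {x} \<subset> A" by blast
    from psubset.IH[OF this] show ?thesis
      using x by (meson Diff_subset order_trans)
  qed
qed

theorem theorem1p3:
  fixes A :: "'a::ab_group_add set" and K M :: real
  assumes "finite A" and "A \<noteq> {}"
    and "real (card (A + A)) \<le> K * real (card A)"
    and "real (card (A + A + A)) \<ge> 1 / M * K powr (3 / 2) * real (card A) powr (3 / 2)"
    and "1 \<le> M" and "M \<le> 1 / 2 * sqrt (real (card A) / K)"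
  shows "\<exists>Y. Y \<subseteq> A
    \<and> sqrt (K * real (card A)) / (2 * M) powr (1 / 3) \<le> real (card Y)
    \<and> real (card Y) < 2 * M * sqrt (K * real (card A))
    \<and> real (card (Y + Y + Y)) \<ge> real (card Y) ^ 3 / (2 * M) ^ 4"
proof -
  define n where "n = real (card A)"
  define r where "r = sqrt (K * n)"
  define L where "L = 2 * M * r"
  have n: "0 < n"
    using assms(1,2) by (simp add: n_def card_gt_0_iff)
  have "n \<le> K * n"
    using card_le_card_double_sumset[OF assms(1)] assms(3) by (simp add: n_def)
  then have K: "1 \<le> K"
    using n by simp
  have r: "0 < r" and r2: "r\<^sup>2 = K * n"
    using K n by (auto simp: r_def)
  have r32: "K powr (3 / 2) * n powr (3 / 2) = r ^ 3"
  proof -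
    have "r ^ 3 = r powr 3"
      using r by (simp add: powr_numeral)
    also have "\<dots> = (K * n) powr (3 / 2)"
      using K n by (simp add: r_def powr_half_sqrt[symmetric] powr_powr)
    finally show ?thesis
      using K n by (simp add: powr_mult)
  qed
  \<comment> \<open>As \<open>M \<ge> 1\<close>, the upper bound on \<open>M\<close> forces \<open>n / K \<ge> 4\<close>; since \<open>K \<ge> 1\<close>, also \<open>r \<ge> 2\<close>.\<close>
  have L4: "4 \<le> L"
  proof -
    have "2 \<le> sqrt (n / K)"
      using assms(5,6) by (simp add: n_def)
    also have "\<dots> \<le> r"
      unfolding r_def
    proof (rule real_sqrt_le_mono)
      have "n / K \<le> n"
        using K n by (simp add: field_simps)
      then show "n / K \<le> K * n"
        using \<open>n \<le> K * n\<close> by linarith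
    qed
    finally have "2 * 2 \<le> 2 * M * r"
      using assms(5) by (intro mult_mono) auto
    then show ?thesis by (simp add: L_def)
  qed
  obtain Y where Y: "Y \<subseteq> A" and YL: "real (card Y) < L"
    and pot: "real (card (A + A + A)) - (real (card (A + A)))\<^sup>2 / L
      \<le> real (card (Y + Y + Y)) - (real (card (Y + Y)))\<^sup>2 / L"
    using exists_small_subset_potential[OF assms(1) L4] by blast
  have finY: "finite Y"
    using Y assms(1) by (rule finite_subset)
  define y where "y = real (card Y)"
  have triple: "r ^ 3 / (2 * M) \<le> real (card (Y + Y + Y))"
  proof -
    have "(real (card (A + A)))\<^sup>2 \<le> (r\<^sup>2)\<^sup>2"
      using assms(3) by (intro power_mono) (auto simp: r2 n_def)
    then have "(real (card (A + A)))\<^sup>2 / L \<le> (r\<^sup>2)\<^sup>2 / L"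
      using L4 by (intro divide_right_mono) auto
    also have "\<dots> = r ^ 3 / (2 * M)"
      using r assms(5) by (simp add: L_def field_simps power2_eq_square power3_eq_cube)
    finally have "(real (card (A + A)))\<^sup>2 / L \<le> r ^ 3 / (2 * M)" .
    moreover have "r ^ 3 / M \<le> real (card (A + A + A))"
      using assms(4) r32 by (simp add: n_def mult.assoc)
    moreover have "r ^ 3 / M = r ^ 3 / (2 * M) + r ^ 3 / (2 * M)"
      by simp
    moreover have "0 \<le> (real (card (Y + Y)))\<^sup>2 / L"
      using L4 by simp
    ultimately show ?thesis
      using pot by linarith
  qed
  have lower: "r / (2 * M) powr (1 / 3) \<le> y"
  proof -
    have "card (Y + Y + Y) \<le> card Y * card Y * card Y"
      using card_set_plus_le[OF finite_set_plus[OF finY finY] finY] card_set_plus_le[OF finY finY]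
      by (meson le_trans mult_le_mono1)
    then have "real (card (Y + Y + Y)) \<le> real (card Y * card Y * card Y)"
      by (rule of_nat_mono)
    then have "r ^ 3 / (2 * M) \<le> y ^ 3"
      using triple by (simp add: y_def power3_eq_cube)
    moreover have "((2 * M) powr (1 / 3)) ^ 3 = 2 * M"
      using assms(5) by (simp add: powr_power)
    ultimately have "(r / (2 * M) powr (1 / 3)) ^ 3 \<le> y ^ 3"
      by (simp only: power_divide)
    moreover have "0 \<le> y"
      by (simp add: y_def)
    ultimately show ?thesis
      using power_strict_mono[of y _ 3] by (metis not_less zero_less_numeral)
  qed
  have upper: "y ^ 3 / (2 * M) ^ 4 \<le> real (card (Y + Y + Y))"
  proof -
    have "y ^ 3 \<le> L ^ 3"
      using YL by (intro power_mono) (auto simp: y_def)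
    then have "y ^ 3 / (2 * M) ^ 4 \<le> L ^ 3 / (2 * M) ^ 4"
      by (intro divide_right_mono) auto
    also have "\<dots> = r ^ 3 / (2 * M)"
    proof -
      have "L ^ 3 = (2 * M) ^ 3 * r ^ 3"
        unfolding L_def by (rule power_mult_distrib)
      moreover have "(2 * M) ^ 4 = (2 * M) ^ 3 * (2 * M)"
        using power_Suc2[of "2 * M" 3] by simp
      moreover have "(2 * M) ^ 3 \<noteq> 0"
        using assms(5) by simp
      ultimately show ?thesis
        by (simp only: mult_divide_mult_cancel_left[OF \<open>(2 * M) ^ 3 \<noteq> 0\<close>])
    qed
    finally show ?thesis
      using triple by linarith
  qed
  show ?thesis
    using Y YL lower upper unfolding y_def L_def r_def n_def by blast
qed

end
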